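(* Let $\Delta$ be either the Paley graph $P(q)$, where $q$ is a prime power satisfying $q\equiv 1\pmod 4$, or the Peisert graph $P^*(q)$, where $q=p^r\ge 5$ is a power of a prime $p$ with $p\equiv 3\pmod 4$ and $r$ even. Let $\Sigma$ be the Taylor extension of $\Delta$, and let $\Gamma$ be the bipartite double of $\Sigma$. Then $\Gamma$ is a connected bipartite amply regular graph with diameter $d=4$ and parameters $(v,k,\lambda,\mu)=\left(4(q+1),\,q,\,0,\,\frac{q-1}{2}\right)$, and $\Gamma$ is a $Q$-regular graph with distribution diagram $\mathcal Q_k$ (defined in the context) with $k=q$.
   Context: All graphs are finite, simple and undirected. An amply regular graph with parameters $(v,k,\lambda,\mu)$ is a $k$-regular graph on $v$ vertices such that every pair of adjacent vertices has exactly $\lambda$ common neighbors and every pair of vertices at distance two has exactly $\mu$ common neighbors. Paley graph $P(q)$: vertex set $\mathbb F_q$, distinct $x,y$ adjacent iff $x-y$ is a nonzero square in $\mathbb F_q$. Peisert graph $P^*(q)$: vertex set $\mathbb F_q$, distinct $x,y$ adjacent iff $x-y\in\{w^j: j\equiv 0,1 \pmod 4\}$, where $w$ is a primitive root of $\mathbb F_q$. Taylor double of a graph $\Delta'$: the graph with vertex set $\{x^{\varepsilon}: x\in V(\Delta'),\ \varepsilon=\pm1\}$ in which $x^\delta$ and $y^\varepsilon$ with $x\ne y$ are adjacent iff $\delta\varepsilon=1$ when $x\sim y$ in $\Delta'$, and $\delta\varepsilon=-1$ when $x\not\sim y$ in $\Delta'$ (and $x^{+1},x^{-1}$ are not adjacent).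 Taylor extension of $\Delta$: the Taylor double of the graph obtained from $\Delta$ by adding a new vertex $\infty$ adjacent to every vertex of $\Delta$. Bipartite double of a graph $\Sigma$: vertex set $V(\Sigma)\times\{0,1\}$, with $(x,i)\sim(y,j)$ iff $x\sim y$ in $\Sigma$ and $i\ne j$. A partition $\{B_1,\dots,B_n\}$ of $V(\Gamma)$ is equitable with quotient matrix $Q=(q_{ij})$ if every vertex of $B_i$ has exactly $q_{ij}$ neighbors in $B_j$, for all $i,j$. The distribution diagram of the partition records the sizes $|B_i|$ and the numbers $q_{ij}$ (it is used interchangeably with the quotient matrix). $\Gamma$ is $Q$-regular if for each vertex $x$ there is an equitable partition of $V(\Gamma)$ with quotient matrix $Q$ such that $\{x\}$ is a part. The distribution diagram $\mathcal Q_k$ has six cells $P_0,P_1,P_2,P_3,P_4,P_5$ of sizes $1,\ k,\ 2k,\ k,\ 1,\ 2$ respectively, with $P_0=\{x\}$, and with the following quotient numbers (all unlisted ones are $0$): $q_{01}=k$; $q_{10}=1$, $q_{12}=k-1$; $q_{21}=\frac{k-1}{2}$, $q_{23}=\frac{k-1}{2}$, $q_{25}=1$; $q_{32}=k-1$, $q_{34}=1$; $q_{43}=k$; $q_{52}=k$. *)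

theory Defs
  imports
    "HOL-Computational_Algebra.Primes"
    "HOL-Number_Theory.Cong"
    "HOL-Library.Cardinality"
    "HOL-Library.Disjoint_Sets"
    "Graph_Theory.Graph_Theory"
begin

text \<open>
  A finite simple undirected graph is a pair digraph \<open>G\<close> with \<open>pair_graph G\<close>: finite,
  loop-free, and with a symmetric arc relation, so that \<open>x \<sim> y\<close> is \<open>(x, y) \<in> parcs G\<close>.
\<close>

definition nbrs :: "'v pair_pre_digraph \<Rightarrow> 'v \<Rightarrow> 'v set" where
  "nbrs G x = {y. (x, y) \<in> parcs G}"

text \<open>Every arc has cost 1, so the cost of a walk is its length.\<close>

definition graph_dist :: "'v pair_pre_digraph \<Rightarrow> 'v \<Rightarrow> 'v \<Rightarrow> ereal" where
  "graph_dist G x y = wf_digraph.\<mu> (with_proj G) (\<lambda>_. 1) x y"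

definition graph_diameter :: "'v pair_pre_digraph \<Rightarrow> ereal" where
  "graph_diameter G = (SUP x \<in> pverts G. SUP y \<in> pverts G. graph_dist G x y)"

definition bipartite_graph :: "'v pair_pre_digraph \<Rightarrow> bool" where
  "bipartite_graph G \<longleftrightarrow>
     pair_graph G \<and>
     (\<exists>U W. U \<union> W = pverts G \<and> U \<inter> W = {} \<and> parcs G \<subseteq> U \<times> W \<union> W \<times> U)"

definition amply_regular ::
    "'v pair_pre_digraph \<Rightarrow> nat \<Rightarrow> nat \<Rightarrow> nat \<Rightarrow> nat \<Rightarrow> bool" where
  "amply_regular G v k l m \<longleftrightarrow>
     pair_graph G \<and>
     card (pverts G) = v \<and>
     (\<forall>x \<in> pverts G. card (nbrs G x) = k) \<and>
     (\<forall>x \<in> pverts G. \<forall>y \<in> pverts G. (x, y) \<in> parcs G \<longrightarrow> card (nbrs G x \<inter> nbrs G y) = l) \<and>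
     (\<forall>x \<in> pverts G. \<forall>y \<in> pverts G. graph_dist G x y = 2 \<longrightarrow> card (nbrs G x \<inter> nbrs G y) = m)"

definition paley_graph :: "'a::field pair_pre_digraph" where
  "paley_graph =
     \<lparr> pverts = UNIV, parcs = {(x, y). x \<noteq> y \<and> x - y \<noteq> 0 \<and> (\<exists>z. x - y = z ^ 2)} \<rparr>"

definition primitive_root :: "'a::field \<Rightarrow> bool" where
  "primitive_root w \<longleftrightarrow> range (\<lambda>j::nat. w ^ j) = UNIV - {0}"

definition peisert_graph :: "'a::field \<Rightarrow> 'a pair_pre_digraph" where
  "peisert_graph w =
     \<lparr> pverts = UNIV,
       parcs = {(x, y). x \<noteq> y \<and>
                  x - y \<in> {w ^ j | j::nat. [j = 0] (mod 4) \<or> [j = 1] (mod 4)}} \<rparr>"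

definition taylor_double :: "'v pair_pre_digraph \<Rightarrow> ('v \<times> int) pair_pre_digraph" where
  "taylor_double G =
     \<lparr> pverts = pverts G \<times> {1, -1},
       parcs = {((x, \<delta>), (y, \<epsilon>)) | x \<delta> y \<epsilon>.
                  x \<in> pverts G \<and> y \<in> pverts G \<and> \<delta> \<in> {1, -1} \<and> \<epsilon> \<in> {1, -1} \<and> x \<noteq> y \<and>
                  (if (x, y) \<in> parcs G then \<delta> * \<epsilon> = 1 else \<delta> * \<epsilon> = -1)} \<rparr>"

text \<open>The new vertex \<open>\<infinity>\<close> is \<open>None\<close>.\<close>

definition add_infinity :: "'v pair_pre_digraph \<Rightarrow> 'v option pair_pre_digraph" where
  "add_infinity G =
     \<lparr> pverts = insert None (Some ` pverts G),
       parcs = {(Some x, Some y) | x y. (x, y) \<in> parcs G} \<union>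
               {(None, Some x) | x. x \<in> pverts G} \<union>
               {(Some x, None) | x. x \<in> pverts G} \<rparr>"

definition taylor_extension ::
    "'v pair_pre_digraph \<Rightarrow> ('v option \<times> int) pair_pre_digraph" where
  "taylor_extension G = taylor_double (add_infinity G)"

definition bipartite_double :: "'v pair_pre_digraph \<Rightarrow> ('v \<times> nat) pair_pre_digraph" where
  "bipartite_double G =
     \<lparr> pverts = pverts G \<times> {0, 1},
       parcs = {((x, i), (y, j)) | x i y j.
                  (x, y) \<in> parcs G \<and> i \<in> {0, 1} \<and> j \<in> {0, 1} \<and> i \<noteq> j} \<rparr>"

text \<open>
  The parts are \<open>B 0, \<dots>, B (n - 1)\<close> and the quotient matrix is \<open>(Q i j)\<close> for \<open>i, j < n\<close>.
\<close>

definition equitable_partition ::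
    "'v pair_pre_digraph \<Rightarrow> nat \<Rightarrow> (nat \<Rightarrow> nat \<Rightarrow> nat) \<Rightarrow> (nat \<Rightarrow> 'v set) \<Rightarrow> bool" where
  "equitable_partition G n Q B \<longleftrightarrow>
     partition_on (pverts G) (B ` {..<n}) \<and> inj_on B {..<n} \<and>
     (\<forall>i<n. \<forall>j<n. \<forall>x \<in> B i. card (nbrs G x \<inter> B j) = Q i j)"

definition Q_regular ::
    "'v pair_pre_digraph \<Rightarrow> nat \<Rightarrow> (nat \<Rightarrow> nat \<Rightarrow> nat) \<Rightarrow> bool" where
  "Q_regular G n Q \<longleftrightarrow>
     pair_graph G \<and>
     (\<forall>x \<in> pverts G. \<exists>B. equitable_partition G n Q B \<and> {x} \<in> B ` {..<n})"

text \<open>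
  Besides the quotient matrix, a distribution diagram also prescribes the sizes of the cells
  and that \<open>{x}\<close> is the cell with index 0.
\<close>

definition Q_regular_with_diagram ::
    "'v pair_pre_digraph \<Rightarrow> nat \<Rightarrow> (nat \<Rightarrow> nat) \<Rightarrow> (nat \<Rightarrow> nat \<Rightarrow> nat) \<Rightarrow> bool" where
  "Q_regular_with_diagram G n s Q \<longleftrightarrow>
     pair_graph G \<and>
     (\<forall>x \<in> pverts G. \<exists>B. equitable_partition G n Q B \<and> B 0 = {x} \<and> (\<forall>i<n. card (B i) = s i))"

definition diagram_sizes :: "nat \<Rightarrow> nat \<Rightarrow> nat" where
  "diagram_sizes k i = [1, k, 2 * k, k, 1, 2] ! i"

text \<open>The diagram is only meant for odd \<open>k\<close>, where the division by 2 is exact.\<close>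

definition diagram_quotient :: "nat \<Rightarrow> nat \<Rightarrow> nat \<Rightarrow> nat" where
  "diagram_quotient k i j =
     [[0, k,             0,     0,             0, 0],
      [1, 0,             k - 1, 0,             0, 0],
      [0, (k - 1) div 2, 0,     (k - 1) div 2, 0, 1],
      [0, 0,             k - 1, 0,             1, 0],
      [0, 0,             0,     k,             0, 0],
      [0, 0,             k,     0,             0, 0]] ! i ! j"

end

theory Submission
  imports Defs "HOL-Algebra.Multiplicative_Group" Complex_Main
begin

text \<open>
  Adding \<open>\<infinity>\<close> to \<open>\<Delta>\<close> gives a graph whose Seidel matrix is a conference matrix: any two
  distinct vertices agree on exactly half of the other \<open>q - 1\<close> vertices. This alone makes the
  cells of a vertex \<open>((x, \<delta>), i)\<close> of \<open>\<Gamma>\<close>, determined by whether the three coordinates of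
  the other vertex agree with it, an equitable partition with the required quotient matrix, and
  the distances and common neighbour counts are read off from that matrix.

  For the conference property, let \<open>w\<close> be a primitive root and \<open>\<psi>\<close> the character with
  \<open>\<psi> w = -1\<close> (Paley) or \<open>\<psi> w = \<i>\<close> (Peisert). In both cases \<open>x\<close> and \<open>y\<close> are adjacent iff
  \<open>\<chi> (x - y) = 1\<close>, where \<open>\<chi> = Re \<psi> + Im \<psi>\<close> has values \<open>\<plusminus>1\<close>. The autocorrelation of \<open>\<chi>\<close> at
  \<open>a \<noteq> 0\<close> is \<open>-1\<close> plus the imaginary part of the sum of \<open>\<psi> (z + a) * \<psi> z\<close> over all \<open>z\<close>,
  and that sum is real: for Paley trivially, for Peisert because the Frobenius map conjugates
  \<open>\<psi>\<close> when \<open>p\<close> is 3 modulo 4.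
\<close>

section \<open>Multiplicative characters of finite fields\<close>

text \<open>The multiplicative group of a finite field is cyclic. The type class operations are
  packed into a ring record \<open>R\<close> so that the carrier-based form of this theorem
  applies.\<close>

lemma exists_primitive_root: "\<exists>w :: 'a::{field, finite}. primitive_root w"
proof -
  define R :: "'a ring" where
    "R = \<lparr>carrier = UNIV, mult = (*), one = 1, zero = 0, add = (+)\<rparr>"
  have inv: "\<exists>y. x * y = 1" if "x \<noteq> 0" for x :: 'a
    using that by (intro exI[of _ "inverse x"]) simp
  interpret field R
    by unfold_locales
      (auto simp: R_def Units_def algebra_simps dest: inv intro: exI[of _ "- x" for x])
  have pow: "w [^]\<^bsub>R\<^esub> n = w ^ n" for w and n :: nat
    by (induction n) (simp_all add: R_def nat_pow_def mult.commute)
  have "finite (carrier R)"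
    by simp
  from finite_field_mult_group_has_gen[OF this]
  obtain w where "carrier (mult_of R) = {w [^]\<^bsub>R\<^esub> i | i :: nat. i \<in> UNIV}"
    by blast
  hence "range (\<lambda>j::nat. w ^ j) = UNIV - {0}"
    unfolding pow by (auto simp: R_def)
  thus ?thesis
    by (auto simp: primitive_root_def)
qed

text \<open>When \<open>u ^ (CARD('a) - 1) = 1\<close>, this is the multiplicative character that
  sends the primitive root \<open>w\<close> to \<open>u\<close>. \<open>LEAST\<close> merely fixes
  one discrete logarithm of \<open>x\<close>.\<close>

definition power_character :: "'a::field \<Rightarrow> complex \<Rightarrow> 'a \<Rightarrow> complex" where
  "power_character w u x = (if x = 0 then 0 else u ^ (LEAST j. x = w ^ j))"

context
  fixes w :: "'a::{field, finite}"
  assumes w: "primitive_root w"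
begin

lemma primitive_root_nonzero: "w \<noteq> 0"
proof
  assume "w = 0"
  have "w ^ 1 \<in> UNIV - {0}"
    using w unfolding primitive_root_def by blast
  with \<open>w = 0\<close> show False by simp
qed

lemma nonzero_is_power:
  assumes "x \<noteq> 0"
  obtains j :: nat where "x = w ^ j"
  using assms w unfolding primitive_root_def by (metis Diff_iff UNIV_I empty_iff insert_iff rangeE)

text \<open>Multiplication by \<open>w\<close> permutes the nonzero elements, so it preserves their
  product, which is nonzero and can be cancelled.\<close>

lemma primitive_root_power_card: "w ^ (CARD('a) - 1) = 1"
proof -
  have "w ^ (CARD('a) - 1) * \<Prod>(UNIV - {0}) = (\<Prod>y\<in>UNIV - {0}. w * y)"
    by (simp add: prod.distrib)
  also have "\<dots> = \<Prod>(UNIV - {0})"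
    by (rule prod.reindex_bij_witness[of _ "\<lambda>y. y / w" "\<lambda>y. w * y"])
      (use primitive_root_nonzero in auto)
  finally show ?thesis
    by simp
qed

lemma primitive_root_power_eq_1_iff: "w ^ j = 1 \<longleftrightarrow> (CARD('a) - 1) dvd j"
proof
  let ?n = "CARD('a) - 1"
  assume "w ^ j = 1"
  have "CARD('a) > 1"
    using card_mono[of UNIV "{0, 1 :: 'a}"] by simp
  have j: "w ^ (j mod ?n) = 1"
  proof -
    have "w ^ j = (w ^ ?n) ^ (j div ?n) * w ^ (j mod ?n)"
      by (simp flip: power_mult power_add)
    thus ?thesis using \<open>w ^ j = 1\<close> primitive_root_power_card by simp
  qed
  show "?n dvd j"
  proof (rule ccontr)
    assume "\<not> ?n dvd j"
    hence pos: "j mod ?n > 0" by (simp add: mod_greater_zero_iff_not_dvd)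
    \<comment> \<open>A remainder \<open>j mod ?n > 0\<close> would be a period of \<open>w\<close>
      shorter than \<open>?n\<close>, and then the powers of \<open>w\<close> could not reach all
      \<open>?n\<close> nonzero elements.\<close>
    have "UNIV - {0} \<subseteq> (\<lambda>i. w ^ i) ` {..<j mod ?n}"
    proof
      fix x assume "x \<in> UNIV - {0 :: 'a}"
      then obtain i where "x = w ^ i" using nonzero_is_power by auto
      also have "\<dots> = (w ^ (j mod ?n)) ^ (i div (j mod ?n)) * w ^ (i mod (j mod ?n))"
        by (simp only: power_mult[symmetric] power_add[symmetric] mult_div_mod_eq)
      finally show "x \<in> (\<lambda>i. w ^ i) ` {..<j mod ?n}" using j pos by simp
    qed
    hence "card (UNIV - {0 :: 'a}) \<le> card {..<j mod ?n}"
      by (rule surj_card_le[rotated]) simp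
    moreover have "j mod ?n < ?n" using \<open>CARD('a) > 1\<close> by simp
    ultimately show False by simp
  qed
next
  assume "(CARD('a) - 1) dvd j"
  thus "w ^ j = 1" using primitive_root_power_card by (metis dvdE power_mult power_one)
qed

text \<open>The power squares to 1 but is not 1, because its exponent lies strictly between 0 and
  \<open>CARD('a) - 1\<close>. The only other square root of 1 is -1.\<close>

lemma minus_one_eq_power:
  assumes "even (CARD('a) - 1)"
  shows "- 1 = w ^ ((CARD('a) - 1) div 2)"
proof -
  let ?m = "(CARD('a) - 1) div 2"
  have "CARD('a) > 1"
    using card_mono[of UNIV "{0, 1 :: 'a}"] by simp
  have "(w ^ ?m)\<^sup>2 = 1"
    using assms primitive_root_power_card by (simp flip: power_mult)
  moreover have "\<not> (CARD('a) - 1) dvd ?m"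
    using \<open>CARD('a) > 1\<close> assms by (intro nat_dvd_not_less) (auto elim!: oddE)
  hence "w ^ ?m \<noteq> 1"
    by (simp only: primitive_root_power_eq_1_iff not_False_eq_True)
  ultimately show ?thesis by (metis power2_eq_1_iff)
qed

text \<open>Two exponents of the same element differ by a multiple of \<open>CARD('a) - 1\<close>,
  on which \<open>u\<close> is trivial. Any exponent may therefore replace the one chosen by
  \<open>LEAST\<close>.\<close>

lemma power_character_power:
  assumes "u ^ (CARD('a) - 1) = 1"
  shows "power_character w u (w ^ j) = u ^ j"
proof -
  define i where "i = (LEAST i. w ^ j = w ^ i)"
  have ij: "w ^ j = w ^ i"
    unfolding i_def by (rule LeastI) simp
  have "i \<le> j"
    unfolding i_def by (rule Least_le) simp
  hence "w ^ i * w ^ (j - i) = w ^ i * 1"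
    using ij by (simp flip: power_add)
  hence "w ^ (j - i) = 1"
    using primitive_root_nonzero by simp
  then obtain m where m: "j - i = (CARD('a) - 1) * m"
    by (auto simp: primitive_root_power_eq_1_iff)
  have "u ^ j = u ^ i * u ^ (j - i)"
    using \<open>i \<le> j\<close> by (simp flip: power_add)
  also have "u ^ (j - i) = 1"
    unfolding m power_mult assms by simp
  finally show ?thesis
    using primitive_root_nonzero by (simp add: power_character_def i_def)
qed

end

section \<open>Character sums over a finite field\<close>

locale mult_character =
  fixes \<psi> :: "'a::{field, finite} \<Rightarrow> complex"
  assumes char_0: "\<psi> 0 = 0"
    and char_mult: "\<psi> (x * y) = \<psi> x * \<psi> y"
    and char_norm: "x \<noteq> 0 \<Longrightarrow> cmod (\<psi> x) = 1"
    and char_nontrivial: "\<exists>x. x \<noteq> 0 \<and> \<psi> x \<noteq> 1"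
begin

lemma char_1: "\<psi> 1 = 1"
  using char_mult[of 1 1] char_norm[of 1] by auto

lemma char_cnj: "x \<noteq> 0 \<Longrightarrow> \<psi> x * cnj (\<psi> x) = 1"
  using char_norm[of x] by (simp add: complex_norm_square[symmetric])

text \<open>Substituting \<open>t * x\<close> for \<open>x\<close>, where
  \<open>\<psi> t \<noteq> 1\<close>, multiplies the sum by \<open>\<psi> t\<close> and yet leaves
  it unchanged.\<close>

lemma sum_char: "(\<Sum>x\<in>UNIV. \<psi> x) = 0"
proof -
  obtain t where t: "t \<noteq> 0" "\<psi> t \<noteq> 1"
    using char_nontrivial by blast
  have "(\<Sum>x\<in>UNIV. \<psi> x) = (\<Sum>x\<in>UNIV. \<psi> (t * x))"
    by (rule sum.reindex_bij_witness[of _ "\<lambda>x. t * x" "\<lambda>x. x / t"]) (use t in auto)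
  also have "\<dots> = \<psi> t * (\<Sum>x\<in>UNIV. \<psi> x)"
    by (simp add: char_mult sum_distrib_left)
  finally have "(1 - \<psi> t) * (\<Sum>x\<in>UNIV. \<psi> x) = 0"
    by (simp add: algebra_simps)
  thus ?thesis using t by simp
qed

text \<open>For \<open>z \<noteq> 0\<close> the summand is \<open>\<psi> (1 + a / z)\<close>, and \<open>1 + a / z\<close> takes every value but \<open>1\<close>.\<close>

lemma sum_char_cnj_shift:
  assumes "a \<noteq> 0"
  shows "(\<Sum>z\<in>UNIV. \<psi> (z + a) * cnj (\<psi> z)) = -1"
proof -
  have "(\<Sum>z\<in>UNIV. \<psi> (z + a) * cnj (\<psi> z)) = (\<Sum>z\<in>UNIV - {0}. \<psi> (z + a) * cnj (\<psi> z))"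
    by (rule sum.mono_neutral_right) (auto simp: char_0)
  also have "\<dots> = (\<Sum>z\<in>UNIV - {0}. \<psi> (1 + a / z))"
  proof (rule sum.cong[OF refl])
    fix z assume z: "z \<in> UNIV - {0 :: 'a}"
    hence "z + a = (1 + a / z) * z" by (simp add: field_simps)
    hence "\<psi> (z + a) * cnj (\<psi> z) = \<psi> (1 + a / z) * (\<psi> z * cnj (\<psi> z))"
      by (simp only: char_mult mult.assoc)
    also have "\<dots> = \<psi> (1 + a / z)"
      using z by (simp add: char_cnj)
    finally show "\<psi> (z + a) * cnj (\<psi> z) = \<psi> (1 + a / z)" .
  qed
  also have "\<dots> = (\<Sum>y\<in>UNIV - {1}. \<psi> y)"
    by (rule sum.reindex_bij_witness[of _ "\<lambda>y. a / (y - 1)" "\<lambda>z. 1 + a / z"])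
      (use assms in \<open>auto simp: field_simps\<close>)
  also have "\<dots> = (\<Sum>y\<in>UNIV. \<psi> y) - \<psi> 1"
    by (simp add: sum_diff1)
  finally show ?thesis
    by (simp add: sum_char char_1)
qed

text \<open>
  The product expands to the real part of \<open>\<psi> (z + a) * cnj (\<psi> z)\<close> plus the imaginary part
  of \<open>\<psi> (z + a) * \<psi> z\<close>.
\<close>

lemma sum_Re_Im_shift:
  assumes "a \<noteq> 0" and "Im (\<Sum>z\<in>UNIV. \<psi> (z + a) * \<psi> z) = 0"
  shows "(\<Sum>z\<in>UNIV. (Re (\<psi> (z + a)) + Im (\<psi> (z + a))) * (Re (\<psi> z) + Im (\<psi> z))) = -1"
proof -
  have "(\<Sum>z\<in>UNIV. (Re (\<psi> (z + a)) + Im (\<psi> (z + a))) * (Re (\<psi> z) + Im (\<psi> z))) =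
      Re (\<Sum>z\<in>UNIV. \<psi> (z + a) * cnj (\<psi> z)) + Im (\<Sum>z\<in>UNIV. \<psi> (z + a) * \<psi> z)"
    unfolding Re_sum Im_sum sum.distrib[symmetric]
    by (rule sum.cong) (simp_all add: algebra_simps)
  thus ?thesis using assms by (simp add: sum_char_cnj_shift)
qed

lemma sum_Re_Im: "(\<Sum>z\<in>UNIV. Re (\<psi> z) + Im (\<psi> z)) = 0"
  using sum_char by (simp add: sum.distrib flip: Re_sum Im_sum)

text \<open>
  Conjugating the sum replaces \<open>a\<close> by \<open>f a\<close>, which changes it by the factor
  \<open>(\<psi> (f a) / \<psi> a)\<^sup>2 = 1\<close>. The map \<open>f\<close> is the identity or the Frobenius map below.
\<close>

lemma Im_sum_shift_eq_0:
  assumes frob: "\<And>x y. f (x + y) = f x + f y" and "bij f"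
    and cnj: "\<And>x. \<psi> (f x) = cnj (\<psi> x)"
    and quartic: "\<And>x. x \<noteq> 0 \<Longrightarrow> \<psi> x ^ 4 = 1"
    and "a \<noteq> 0"
  shows "Im (\<Sum>z\<in>UNIV. \<psi> (z + a) * \<psi> z) = 0"
proof -
  define J where "J = (\<Sum>z\<in>UNIV. \<psi> (z + 1) * \<psi> z)"
  \<comment> \<open>Substituting \<open>b * z\<close> for \<open>z\<close> pulls out the factor
    \<open>\<psi> b\<close> twice, so every shift reduces to the shift by 1.\<close>
  have scale: "(\<Sum>z\<in>UNIV. \<psi> (z + b) * \<psi> z) = \<psi> b ^ 2 * J" if "b \<noteq> 0" for b
  proof -
    have "(\<Sum>z\<in>UNIV. \<psi> (z + b) * \<psi> z) = (\<Sum>z\<in>UNIV. \<psi> (b * z + b) * \<psi> (b * z))"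
      by (rule sum.reindex_bij_witness[of _ "\<lambda>z. b * z" "\<lambda>z. z / b"]) (use that in auto)
    also have "\<dots> = (\<Sum>z\<in>UNIV. \<psi> b ^ 2 * (\<psi> (z + 1) * \<psi> z))"
    proof (rule sum.cong[OF refl])
      fix z
      have "b * z + b = b * (z + 1)" by (simp add: algebra_simps)
      thus "\<psi> (b * z + b) * \<psi> (b * z) = \<psi> b ^ 2 * (\<psi> (z + 1) * \<psi> z)"
        by (simp only: char_mult power2_eq_square) (simp add: algebra_simps)
    qed
    finally show ?thesis by (simp add: J_def sum_distrib_left)
  qed
  have cnj_sum: "cnj (\<Sum>z\<in>UNIV. \<psi> (z + b) * \<psi> z) = (\<Sum>z\<in>UNIV. \<psi> (z + f b) * \<psi> z)" for b
  proof -
    have "cnj (\<Sum>z\<in>UNIV. \<psi> (z + b) * \<psi> z) = (\<Sum>z\<in>UNIV. \<psi> (f z + f b) * \<psi> (f z))"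
      by (simp add: cnj frob[symmetric])
    also have "\<dots> = (\<Sum>z\<in>UNIV. \<psi> (z + f b) * \<psi> z)"
      using sum.reindex_bij_betw[OF \<open>bij f\<close>, of "\<lambda>z. \<psi> (z + f b) * \<psi> z"] by simp
    finally show ?thesis .
  qed
  \<comment> \<open>The square of a fourth root of unity is 1 or -1, and conjugation fixes
    both.\<close>
  have sq_real: "cnj (\<psi> b ^ 2) = \<psi> b ^ 2" if "b \<noteq> 0" for b
  proof -
    have "(\<psi> b ^ 2) ^ 2 = 1" using quartic[OF that] by (simp flip: power_mult)
    hence "\<psi> b ^ 2 = 1 \<or> \<psi> b ^ 2 = -1" by (rule power2_eq_1_iff[THEN iffD1])
    thus ?thesis by (metis complex_cnj_one complex_cnj_minus)
  qed
  have f0: "f 0 = 0" using frob[of 0 0] by (metis add.right_neutral add_left_cancel)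
  have "f a \<noteq> 0"
    using \<open>a \<noteq> 0\<close> f0 \<open>bij f\<close> by (metis bij_pointE)
  have "cnj (\<Sum>z\<in>UNIV. \<psi> (z + a) * \<psi> z) = \<psi> (f a) ^ 2 * J"
    unfolding cnj_sum scale[OF \<open>f a \<noteq> 0\<close>] ..
  also have "\<psi> (f a) ^ 2 = \<psi> a ^ 2"
    using sq_real[OF \<open>a \<noteq> 0\<close>] by (simp add: cnj)
  also have "\<psi> a ^ 2 * J = (\<Sum>z\<in>UNIV. \<psi> (z + a) * \<psi> z)"
    using scale[OF \<open>a \<noteq> 0\<close>] by simp
  finally show ?thesis
    by (metis Reals_cnj_iff complex_is_Real_iff)
qed

end

lemma mult_character_power_character:
  fixes w :: "'a::{field, finite}"
  assumes w: "primitive_root w" and u: "u ^ (CARD('a) - 1) = 1" "cmod u = 1" "u \<noteq> 1"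
  shows "mult_character (power_character w u)"
proof
  note pw = power_character_power[OF w u(1)]
  show "power_character w u 0 = 0"
    by (simp add: power_character_def)
  show "power_character w u (x * y) = power_character w u x * power_character w u y" for x y
  proof (cases "x = 0 \<or> y = 0")
    case True
    thus ?thesis by (auto simp: power_character_def)
  next
    case False
    then obtain i j where "x = w ^ i" "y = w ^ j"
      using nonzero_is_power[OF w] by metis
    thus ?thesis by (simp add: pw flip: power_add)
  qed
  show "cmod (power_character w u x) = 1" if "x \<noteq> 0" for x
    using that u(2) by (simp add: power_character_def norm_power)
  show "\<exists>x. x \<noteq> 0 \<and> power_character w u x \<noteq> 1"
    using pw[of 1] primitive_root_nonzero[OF w] u(3) by (intro exI[of _ w]) simp
qed

text \<open>Translation by 1 permutes the field but adds \<open>CARD('a)\<close> ones to the sum of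
  all elements. Hence \<open>p ^ r\<close>, and with it \<open>p\<close>, vanishes in the field, so
  the characteristic is a divisor of \<open>p\<close> other than 1.\<close>

lemma char_of_card_prime_power:
  assumes "prime p" and "CARD('a::{field, finite}) = p ^ r"
  shows "CHAR('a) = p"
proof -
  have "(\<Sum>x\<in>UNIV. x :: 'a) = (\<Sum>x\<in>UNIV. x + 1)"
    by (rule sum.reindex_bij_witness[of _ "\<lambda>x. x + 1" "\<lambda>x. x - 1"]) auto
  hence "of_nat (CARD('a)) = (0 :: 'a)"
    by (simp add: sum.distrib)
  hence "of_nat p = (0 :: 'a)"
    using assms by simp
  hence "CHAR('a) dvd p"
    by (simp add: of_nat_eq_0_iff_char_dvd)
  thus ?thesis
    using assms(1) CHAR_not_1' by (metis One_nat_def prime_nat_iff)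
qed

section \<open>Walks and distances\<close>

text \<open>Together with the converse \<open>relpow_of_awalk\<close>, this lets distances be
  bounded by induction on powers of the arc relation. For \<open>n = 0\<close> the empty walk is
  legal only at a vertex, hence the second premise.\<close>

lemma (in pair_wf_digraph) awalk_of_relpow:
  assumes "(u, v) \<in> parcs G ^^ n" and "u \<in> pverts G"
  shows "\<exists>p. awalk u p v \<and> length p = n"
  using assms
proof (induction n arbitrary: u)
  case 0
  thus ?case by (auto simp: awalk_Nil_iff)
next
  case (Suc n)
  then obtain x where x: "(u, x) \<in> parcs G" "(x, v) \<in> parcs G ^^ n"
    by (meson relpow_Suc_D2)
  with Suc.IH obtain p where "awalk x p v" "length p = n"
    using in_arcsD2 by blast
  with x show ?case
    by (intro exI[of _ "(u, x) # p"]) (simp add: awalk_Cons_iff)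
qed

lemma (in pair_wf_digraph) relpow_of_awalk: "awalk u p v \<Longrightarrow> (u, v) \<in> parcs G ^^ length p"
proof (induction p arbitrary: u)
  case Nil
  thus ?case by (simp add: awalk_Nil_iff)
next
  case (Cons e p)
  hence "(fst e, snd e) \<in> parcs G" "fst e = u" "(snd e, v) \<in> parcs G ^^ length p"
    by (auto simp: awalk_Cons_iff)
  thus ?case
    by (metis length_Cons relpow_Suc_I2)
qed

lemma (in pair_wf_digraph) graph_dist_le:
  assumes "(u, v) \<in> parcs G ^^ n" and "u \<in> pverts G"
  shows "graph_dist G u v \<le> ereal (real n)"
proof -
  obtain p where "awalk u p v" "length p = n"
    using awalk_of_relpow[OF assms] by blast
  thus ?thesis
    using min_cost_le_walk_cost[of u p v "\<lambda>_. 1"]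
    by (simp add: graph_dist_def awalk_cost_def sum_list_triv)
qed

lemma (in pair_wf_digraph) graph_dist_ge:
  assumes "\<And>n. (u, v) \<in> parcs G ^^ n \<Longrightarrow> c \<le> ereal (real n)"
  shows "c \<le> graph_dist G u v"
  unfolding graph_dist_def \<mu>_def
  using assms relpow_of_awalk by (auto intro!: INF_greatest simp: awalk_cost_def sum_list_triv)

text \<open>Connectedness means strong connectedness of the symmetric closure, and that closure
  contains every walk of the graph itself.\<close>

lemma (in pair_wf_digraph) connected_if_relpow:
  assumes "pverts G \<noteq> {}"
    and "\<And>u v. u \<in> pverts G \<Longrightarrow> v \<in> pverts G \<Longrightarrow> \<exists>n. (u, v) \<in> parcs G ^^ n"
  shows "Digraph_Component.connected (with_proj G)"
  unfolding Digraph_Component.connected_def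
proof (rule strongly_connectedI)
  show "verts (mk_symmetric G) \<noteq> {}"
    using assms(1) by simp
  fix u v assume "u \<in> verts (mk_symmetric G)" "v \<in> verts (mk_symmetric G)"
  hence uv: "u \<in> pverts G" "v \<in> pverts G" by simp_all
  with assms(2) obtain n where "(u, v) \<in> parcs G ^^ n" by blast
  with uv awalk_of_relpow obtain p where "awalk u p v" by blast
  thus "u \<rightarrow>\<^sup>*\<^bsub>mk_symmetric G\<^esub> v"
    by (intro reachable_mk_symmetricI reachable_awalkI)
qed

section \<open>The double of a conference graph\<close>

text \<open>\<open>card_agree\<close> is the orthogonality of two rows of the conference matrix in
  counting form. The bound \<open>q \<ge> 3\<close> makes the cell sizes and the entry
  \<open>(q - 1) div 2\<close> positive.\<close>

locale conference_graph = pair_graph H for H :: "'v pair_pre_digraph" +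
  fixes q :: nat
  assumes card_verts: "card (pverts H) = Suc q"
    and odd_q: "odd q" and q_ge_3: "q \<ge> 3"
    and card_agree: "\<lbrakk>x \<in> pverts H; y \<in> pverts H; x \<noteq> y\<rbrakk> \<Longrightarrow>
      card {z \<in> pverts H - {x, y}. (x, z) \<in> parcs H \<longleftrightarrow> (y, z) \<in> parcs H} = (q - 1) div 2"
begin

abbreviation V :: "'v set" where "V \<equiv> pverts H"

text \<open>The customary Seidel matrix has the opposite signs; here the sign is the one picked up
  along an arc of the Taylor double. The diagonal value -1 is a default, since arcs join distinct
  base vertices.\<close>

definition seidel :: "'v \<Rightarrow> 'v \<Rightarrow> int" where
  "seidel x y = (if (x, y) \<in> parcs H then 1 else -1)"

abbreviation \<Gamma> :: "(('v \<times> int) \<times> nat) pair_pre_digraph" where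
  "\<Gamma> \<equiv> bipartite_double (taylor_double H)"

lemma finite_V: "finite V"
  by (rule pair_finite_verts)

lemma seidel_cases: "seidel x y = 1 \<or> seidel x y = -1"
  by (simp add: seidel_def)

lemma seidel_sym: "seidel x y = seidel y x"
  using pair_sym_arcs by (auto simp: seidel_def symmetric_def dest: symD)

text \<open>Equal signs give the agreement set of \<open>card_agree\<close>, opposite signs its
  complement among the other \<open>q - 1\<close> vertices. As \<open>q - 1\<close> is even, both
  are exactly half.\<close>

lemma card_seidel_eq:
  assumes "x \<in> V" "y \<in> V" "x \<noteq> y" and \<epsilon>: "\<delta> \<in> {1, -1}" "\<epsilon> \<in> {1, -1}"
  shows "card {z \<in> V - {x, y}. \<delta> * seidel x z = \<epsilon> * seidel y z} = (q - 1) div 2"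
proof (cases "\<delta> = \<epsilon>")
  case True
  have "{z \<in> V - {x, y}. \<delta> * seidel x z = \<epsilon> * seidel y z} =
        {z \<in> V - {x, y}. (x, z) \<in> parcs H \<longleftrightarrow> (y, z) \<in> parcs H}"
    using True \<epsilon> by (auto simp: seidel_def split: if_splits)
  thus ?thesis using card_agree assms by simp
next
  case False
  let ?A = "{z \<in> V - {x, y}. (x, z) \<in> parcs H \<longleftrightarrow> (y, z) \<in> parcs H}"
  have "{z \<in> V - {x, y}. \<delta> * seidel x z = \<epsilon> * seidel y z} = (V - {x, y}) - ?A"
    using False \<epsilon> by (auto simp: seidel_def split: if_splits)
  moreover have "card ((V - {x, y}) - ?A) = card (V - {x, y}) - card ?A"
    using finite_V by (intro card_Diff_subset) auto
  moreover have "card (V - {x, y}) = q - 1"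
    using assms finite_V by (simp add: card_Diff_subset card_verts)
  moreover have "q - 1 - (q - 1) div 2 = (q - 1) div 2"
  proof -
    obtain k where "q = 2 * k + 1" using odd_q by (rule oddE)
    thus ?thesis by simp
  qed
  ultimately show ?thesis
    using card_agree[OF assms(1-3)] by simp
qed

lemma pverts_\<Gamma>: "pverts \<Gamma> = (V \<times> {1, -1}) \<times> {0, 1}"
  by (simp add: bipartite_double_def taylor_double_def)

text \<open>Since \<open>\<delta>\<close> squares to 1, the defining condition can be solved for the
  second endpoint: a vertex has exactly one neighbour over each other base vertex, and
  \<open>1 - i\<close> swaps the two layers.\<close>

lemma arc_\<Gamma>_iff:
  "(((x, \<delta>), i), ((y, \<epsilon>), j)) \<in> parcs \<Gamma> \<longleftrightarrow>
     x \<in> V \<and> y \<in> V \<and> x \<noteq> y \<and> \<delta> \<in> {1, -1} \<and> \<epsilon> = \<delta> * seidel x y \<and> i \<in> {0, 1} \<and> j = 1 - i"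
  by (auto simp: bipartite_double_def taylor_double_def seidel_def split: if_splits)

lemma pair_graph_\<Gamma>: "pair_graph \<Gamma>"
proof
  have fin: "finite (pverts \<Gamma>)"
    by (simp add: pverts_\<Gamma> finite_V)
  have sub: "parcs \<Gamma> \<subseteq> pverts \<Gamma> \<times> pverts \<Gamma>"
    using seidel_cases by (fastforce simp: arc_\<Gamma>_iff pverts_\<Gamma>)
  show "finite (pverts \<Gamma>)" by (fact fin)
  show "finite (parcs \<Gamma>)"
    using sub fin by (meson finite_SigmaI finite_subset)
  fix e assume e: "e \<in> parcs \<Gamma>"
  show "fst e \<in> pverts \<Gamma>" "snd e \<in> pverts \<Gamma>"
    using sub e by auto
  obtain x \<delta> i y \<epsilon> j where "e = (((x, \<delta>), i), ((y, \<epsilon>), j))"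
    by (metis prod.collapse)
  with e show "fst e \<noteq> snd e"
    by (simp add: arc_\<Gamma>_iff)
next
  have "(b, a) \<in> parcs \<Gamma>" if "(a, b) \<in> parcs \<Gamma>" for a b
  proof -
    obtain x \<delta> i y \<epsilon> j where [simp]: "a = ((x, \<delta>), i)" "b = ((y, \<epsilon>), j)"
      by (metis prod.collapse)
    show ?thesis
      using that seidel_cases[of x y] seidel_sym[of x y] by (auto simp: arc_\<Gamma>_iff)
  qed
  thus "symmetric \<Gamma>"
    by (auto simp: symmetric_def intro: symI)
qed

lemma nbrs_\<Gamma>:
  assumes "x \<in> V" "\<delta> \<in> {1, -1}" "i \<in> {0, 1}"
  shows "nbrs \<Gamma> ((x, \<delta>), i) = (\<lambda>z. ((z, \<delta> * seidel x z), 1 - i)) ` (V - {x})"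
  using assms by (auto simp: nbrs_def arc_\<Gamma>_iff)

lemma card_nbrs_\<Gamma>_Int:
  assumes "x \<in> V" "\<delta> \<in> {1, -1}" "i \<in> {0, 1}"
  shows "card (nbrs \<Gamma> ((x, \<delta>), i) \<inter> B) = card {z \<in> V - {x}. ((z, \<delta> * seidel x z), 1 - i) \<in> B}"
proof -
  let ?f = "\<lambda>z. ((z, \<delta> * seidel x z), 1 - i)"
  have "nbrs \<Gamma> ((x, \<delta>), i) \<inter> B = ?f ` {z \<in> V - {x}. ?f z \<in> B}"
    using nbrs_\<Gamma>[OF assms] by auto
  thus ?thesis
    by (simp add: card_image inj_on_def)
qed

section \<open>The six cells around a vertex: quotient matrix and sizes\<close>

text \<open>The numbering is that of the diagram. Seen from the first argument, 0 is the vertex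
  itself, 4 its antipode in the same layer, 5 the two lifts of its base vertex in the other layer, 2
  the rest of its own layer, 1 its neighbours and 3 their antipodes.\<close>

fun cell :: "('v \<times> int) \<times> nat \<Rightarrow> ('v \<times> int) \<times> nat \<Rightarrow> nat" where
  "cell ((x, \<delta>), i) ((y, \<epsilon>), j) =
     (if y = x then (if j = i then (if \<epsilon> = \<delta> then 0 else 4) else 5)
      else (if j = i then 2 else (if \<epsilon> = \<delta> * seidel x y then 1 else 3)))"

declare cell.simps [simp del]

definition cells :: "('v \<times> int) \<times> nat \<Rightarrow> nat \<Rightarrow> (('v \<times> int) \<times> nat) set" where
  "cells u m = {v \<in> pverts \<Gamma>. cell u v = m}"

lemma cell_less: "cell u v < 6"
  by (cases "(u, v)" rule: cell.cases) (auto simp: cell.simps)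

text \<open>A step changes the layer, so it suffices to ask whether \<open>v\<close> lies over the
  base vertex of \<open>u\<close> and whether it lies in the layer of \<open>u\<close>. Only row 2
  of the matrix needs the conference property; the other rows are direct counts.\<close>

lemma card_nbrs_cells:
  assumes u: "u \<in> pverts \<Gamma>" and v: "v \<in> cells u m" and n: "n < 6"
  shows "card (nbrs \<Gamma> v \<inter> cells u n) = diagram_quotient q m n"
proof -
  obtain x \<delta> i where [simp]: "u = ((x, \<delta>), i)" and x: "x \<in> V" "\<delta> \<in> {1, -1}" "i \<in> {0, 1}"
    using u by (auto simp: pverts_\<Gamma>)
  obtain y \<epsilon> j where [simp]: "v = ((y, \<epsilon>), j)" and y: "y \<in> V" "\<epsilon> \<in> {1, -1}" "j \<in> {0, 1}"
    and m: "m = cell u v"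
    using v by (auto simp: pverts_\<Gamma> cells_def)
  define N where "N n = {z \<in> V - {y}. cell u ((z, \<epsilon> * seidel y z), 1 - j) = n}" for n
  have "card (nbrs \<Gamma> v \<inter> cells u n) =
      card {z \<in> V - {y}. ((z, \<epsilon> * seidel y z), 1 - j) \<in> cells u n}"
    using card_nbrs_\<Gamma>_Int[OF y] by simp
  also have "{z \<in> V - {y}. ((z, \<epsilon> * seidel y z), 1 - j) \<in> cells u n} = N n"
  proof -
    have "((z, \<epsilon> * seidel y z), 1 - j) \<in> pverts \<Gamma>" if "z \<in> V" for z
      using that y seidel_cases[of y z] by (auto simp: pverts_\<Gamma>)
    thus ?thesis
      unfolding cells_def N_def by blast
  qed
  finally have card: "card (nbrs \<Gamma> v \<inter> cells u n) = card (N n)" .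
  have cardV: "card (V - {y}) = q"
    using y finite_V by (simp add: card_verts)
  have n: "n = 0 \<or> n = 1 \<or> n = 2 \<or> n = 3 \<or> n = 4 \<or> n = 5"
    using n by linarith
  have seidel_nz: "seidel a b \<noteq> 0" for a b
    by (simp add: seidel_def)
  have i: "1 - i \<noteq> i" "1 - (1 - i) = i" and j_cases: "j = i \<or> j = 1 - i"
    using x(3) y(3) by auto
  consider (self) "y = x" "j = i" | (opposite) "y = x" "j = 1 - i"
    | (even) "y \<noteq> x" "j = i" | (odd) "y \<noteq> x" "j = 1 - i"
    using j_cases by blast
  thus ?thesis
  proof cases
    case self
    \<comment> \<open>If \<open>v\<close> is \<open>u\<close>, all its neighbours are in cell 1; if
      \<open>v\<close> is the antipode of \<open>u\<close>, all signs are reversed and they are in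
      cell 3.\<close>
    define g :: nat where "g = (if \<epsilon> = \<delta> then 1 else 3)"
    have "cell u ((z, \<epsilon> * seidel y z), 1 - j) = g" if "z \<in> V - {y}" for z
      using that self i seidel_nz by (simp add: cell.simps g_def)
    hence "N n = (if n = g then V - {y} else {})"
      unfolding N_def by auto
    moreover have "m = (if \<epsilon> = \<delta> then 0 else 4)"
      using self by (simp add: m cell.simps)
    ultimately show ?thesis
      unfolding card using n cardV by (auto simp: diagram_quotient_def g_def)
  next
    case opposite
    have "cell u ((z, \<epsilon> * seidel y z), 1 - j) = 2" if "z \<in> V - {y}" for z
      using that opposite i by (simp add: cell.simps)
    hence "N n = (if n = 2 then V - {y} else {})"
      unfolding N_def by auto
    moreover have "m = 5"
      using opposite i by (simp add: m cell.simps)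
    ultimately show ?thesis
      unfolding card using n cardV by (auto simp: diagram_quotient_def)
  next
    case even
    have cell: "cell u ((z, \<epsilon> * seidel y z), 1 - j) =
        (if z = x then 5 else if \<delta> * seidel x z = \<epsilon> * seidel y z then 1 else 3)" for z
      using even i by (auto simp: cell.simps)
    \<comment> \<open>Signs that differ are negatives of each other, so the count for cell 3 is
      again an instance of \<open>card_seidel_eq\<close>, with \<open>- \<epsilon>\<close>.\<close>
    have neq: "\<delta> * seidel x z \<noteq> \<epsilon> * seidel y z \<longleftrightarrow> \<delta> * seidel x z = - \<epsilon> * seidel y z" for z
      using x(2) y(2) seidel_cases[of x z] seidel_cases[of y z] by auto
    have "N 5 = {x}" "N 0 = {}" "N 2 = {}" "N 4 = {}"
      unfolding N_def cell using even x(1) by auto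
    moreover have "N 1 = {z \<in> V - {x, y}. \<delta> * seidel x z = \<epsilon> * seidel y z}"
      unfolding N_def cell by auto
    moreover have "N 3 = {z \<in> V - {x, y}. \<delta> * seidel x z = - \<epsilon> * seidel y z}"
      unfolding N_def cell neq[symmetric] by auto
    moreover have "- \<epsilon> \<in> {1, -1}"
      using y(2) by auto
    moreover have "m = 2"
      using even by (simp add: m cell.simps)
    ultimately show ?thesis
      unfolding card
      using n y(2) card_seidel_eq[OF x(1) y(1) even(1)[symmetric] x(2), of \<epsilon>]
        card_seidel_eq[OF x(1) y(1) even(1)[symmetric] x(2), of "- \<epsilon>"]
      by (elim disjE) (simp_all add: diagram_quotient_def)
  next
    case odd
    \<comment> \<open>The single neighbour of \<open>v\<close> over \<open>x\<close> is in the layer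
      of \<open>u\<close>, hence it is \<open>u\<close> (cell 0) or the antipode of \<open>u\<close>
      (cell 4).\<close>
    define g :: nat where "g = (if \<epsilon> = \<delta> * seidel x y then 0 else 4)"
    have "\<epsilon> * seidel y x = \<delta> \<longleftrightarrow> \<epsilon> = \<delta> * seidel x y"
      using seidel_cases[of x y] seidel_sym[of x y] by auto
    hence "cell u ((z, \<epsilon> * seidel y z), 1 - j) = (if z = x then g else 2)" for z
      using odd i by (auto simp: cell.simps g_def)
    hence "N n = (if n = 2 then V - {x, y} else if n = g then {x} else {})"
      unfolding N_def using odd x(1) by (auto simp: g_def)
    moreover have "card (V - {x, y}) = q - 1"
      using x(1) y(1) odd finite_V by (simp add: card_Diff_subset card_verts)
    moreover have "m = (if \<epsilon> = \<delta> * seidel x y then 1 else 3)"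
      using odd i by (simp add: m cell.simps)
    ultimately show ?thesis
      unfolding card using n by (auto simp: diagram_quotient_def g_def)
  qed
qed

text \<open>Each cell is a singleton, a product, or the image of \<open>V - {x}\<close> under an
  injective lift, which yields its size.\<close>

lemma card_cells:
  assumes u: "u \<in> pverts \<Gamma>" and "m < 6"
  shows "card (cells u m) = diagram_sizes q m"
proof -
  obtain x \<delta> i where [simp]: "u = ((x, \<delta>), i)" and x: "x \<in> V" "\<delta> \<in> {1, -1}" "i \<in> {0, 1}"
    using u by (auto simp: pverts_\<Gamma>)
  have cardV: "card (V - {x}) = q"
    using x finite_V by (simp add: card_verts)
  have cells_eqI: "cells u m = B"
    if "\<And>y \<epsilon> j. ((y, \<epsilon>), j) \<in> B \<longleftrightarrow>
      y \<in> V \<and> \<epsilon> \<in> {1, -1} \<and> j \<in> {0, 1} \<and> cell u ((y, \<epsilon>), j) = m" for m B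
  proof -
    have "v \<in> cells u m \<longleftrightarrow> v \<in> B" for v
      using that[of "fst (fst v)" "snd (fst v)" "snd v"]
      by (cases v) (auto simp: cells_def pverts_\<Gamma>)
    thus ?thesis by blast
  qed
  have c0: "cells u 0 = {((x, \<delta>), i)}"
    using x by (intro cells_eqI) (auto simp: cell.simps)
  have c4: "cells u 4 = {((x, - \<delta>), i)}"
    using x by (intro cells_eqI) (auto simp: cell.simps)
  have c5: "cells u 5 = ({x} \<times> {1, -1}) \<times> {1 - i}"
    using x by (intro cells_eqI) (auto simp: cell.simps)
  have c2: "cells u 2 = ((V - {x}) \<times> {1, -1}) \<times> {i}"
    using x by (intro cells_eqI) (auto simp: cell.simps)
  have i: "j \<in> {0, 1} \<and> j \<noteq> i \<longleftrightarrow> j = 1 - i" for j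
    using x(3) by auto
  have sign: "\<epsilon> \<in> {1, -1} \<and> \<epsilon> \<noteq> \<delta> * seidel x y \<longleftrightarrow> \<epsilon> = - \<delta> * seidel x y"
    "\<delta> * seidel x y \<in> {1, -1}" for \<epsilon> y
    using x(2) seidel_cases[of x y] by auto
  have c1: "cells u 1 = (\<lambda>y. ((y, \<delta> * seidel x y), 1 - i)) ` (V - {x})"
  proof (rule cells_eqI)
    fix y \<epsilon> j
    have "((y, \<epsilon>), j) \<in> (\<lambda>y. ((y, \<delta> * seidel x y), 1 - i)) ` (V - {x}) \<longleftrightarrow>
        y \<in> V \<and> y \<noteq> x \<and> \<epsilon> = \<delta> * seidel x y \<and> j = 1 - i"
      by blast
    moreover have "cell u ((y, \<epsilon>), j) = 1 \<longleftrightarrow> y \<noteq> x \<and> j \<noteq> i \<and> \<epsilon> = \<delta> * seidel x y"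
      by (simp add: cell.simps)
    moreover have "\<epsilon> = \<delta> * seidel x y \<Longrightarrow> \<epsilon> \<in> {1, -1}"
      using sign(2)[of y] by simp
    ultimately show "((y, \<epsilon>), j) \<in> (\<lambda>y. ((y, \<delta> * seidel x y), 1 - i)) ` (V - {x}) \<longleftrightarrow>
        y \<in> V \<and> \<epsilon> \<in> {1, -1} \<and> j \<in> {0, 1} \<and> cell u ((y, \<epsilon>), j) = 1"
      using i[of j] by argo
  qed
  have c3: "cells u 3 = (\<lambda>y. ((y, - \<delta> * seidel x y), 1 - i)) ` (V - {x})"
  proof (rule cells_eqI)
    fix y \<epsilon> j
    have "((y, \<epsilon>), j) \<in> (\<lambda>y. ((y, - \<delta> * seidel x y), 1 - i)) ` (V - {x}) \<longleftrightarrow>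
        y \<in> V \<and> y \<noteq> x \<and> \<epsilon> = - \<delta> * seidel x y \<and> j = 1 - i"
      by blast
    moreover have "cell u ((y, \<epsilon>), j) = 3 \<longleftrightarrow> y \<noteq> x \<and> j \<noteq> i \<and> \<epsilon> \<noteq> \<delta> * seidel x y"
      by (simp add: cell.simps)
    ultimately show "((y, \<epsilon>), j) \<in> (\<lambda>y. ((y, - \<delta> * seidel x y), 1 - i)) ` (V - {x}) \<longleftrightarrow>
        y \<in> V \<and> \<epsilon> \<in> {1, -1} \<and> j \<in> {0, 1} \<and> cell u ((y, \<epsilon>), j) = 3"
      using i[of j] sign(1)[of \<epsilon> y] by argo
  qed
  have "m = 0 \<or> m = 1 \<or> m = 2 \<or> m = 3 \<or> m = 4 \<or> m = 5"
    using assms(2) by linarith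
  moreover have "card (cells u 1) = q" "card (cells u 3) = q"
    unfolding c1 c3 by (simp_all add: card_image inj_on_def cardV)
  moreover have "card (cells u 5) = 2" "card (cells u 2) = 2 * q"
    unfolding c2 c5 by (simp_all add: card_cartesian_product cardV)
  ultimately show ?thesis
    using c0 c4 by (auto simp: diagram_sizes_def)
qed

lemma cells_self:
  assumes "u \<in> pverts \<Gamma>"
  shows "cells u 0 = {u}"
proof -
  have "u \<in> cells u 0"
    using assms by (cases "(u, u)" rule: cell.cases) (auto simp: cells_def cell.simps)
  moreover have "card (cells u 0) = 1"
    using card_cells[OF assms, of 0] by (simp add: diagram_sizes_def)
  ultimately show ?thesis
    by (metis card_1_singletonE singletonD)
qed

lemma equitable_cells:
  assumes u: "u \<in> pverts \<Gamma>"
  shows "equitable_partition \<Gamma> 6 (diagram_quotient q) (cells u)"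
proof -
  \<comment> \<open>Nonemptiness serves twice: \<open>partition_on\<close> forbids empty parts, and
    disjoint cells with different indices could coincide only if empty, which gives
    injectivity.\<close>
  have ne: "cells u m \<noteq> {}" if "m < 6" for m
  proof -
    have "m = 0 \<or> m = 1 \<or> m = 2 \<or> m = 3 \<or> m = 4 \<or> m = 5"
      using that by linarith
    hence "diagram_sizes q m > 0"
      using q_ge_3 by (auto simp: diagram_sizes_def)
    thus ?thesis
      using card_cells[OF u that] by auto
  qed
  have disj: "cells u m \<inter> cells u n = {}" if "m \<noteq> n" for m n
    using that by (auto simp: cells_def)
  have "partition_on (pverts \<Gamma>) (cells u ` {..<6})"
  proof (rule partition_onI)
    show "\<Union> (cells u ` {..<6}) = pverts \<Gamma>"
      unfolding cells_def using cell_less by blast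
    show "disjnt A B" if AB: "A \<in> cells u ` {..<6}" "B \<in> cells u ` {..<6}" "A \<noteq> B" for A B
    proof -
      obtain m n where "A = cells u m" "B = cells u n"
        using AB by blast
      with disj[of m n] \<open>A \<noteq> B\<close> show ?thesis
        by (cases "m = n") (simp_all add: disjnt_def)
    qed
    show "{} \<notin> cells u ` {..<6}"
      using ne by auto
  qed
  moreover have "inj_on (cells u) {..<6}"
  proof (rule inj_onI)
    fix m n assume "m \<in> {..<6}" "cells u m = cells u n"
    with ne[of m] disj[of m n] show "m = n"
      by (cases "m = n") simp_all
  qed
  ultimately show ?thesis
    using card_nbrs_cells[OF u] by (simp add: equitable_partition_def)
qed

lemma Q_regular_with_diagram_\<Gamma>:
  "Q_regular_with_diagram \<Gamma> 6 (diagram_sizes q) (diagram_quotient q)"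
  unfolding Q_regular_with_diagram_def
proof (intro conjI ballI pair_graph_\<Gamma> exI)
  fix u assume u: "u \<in> pverts \<Gamma>"
  show "equitable_partition \<Gamma> 6 (diagram_quotient q) (cells u)" "cells u 0 = {u}"
    "\<forall>i<6. card (cells u i) = diagram_sizes q i"
    using equitable_cells[OF u] cells_self[OF u] card_cells[OF u] by blast+
qed

lemma Q_regular_\<Gamma>: "Q_regular \<Gamma> 6 (diagram_quotient q)"
  unfolding Q_regular_def
proof (intro conjI ballI pair_graph_\<Gamma> exI)
  fix u assume u: "u \<in> pverts \<Gamma>"
  show "equitable_partition \<Gamma> 6 (diagram_quotient q) (cells u)"
    by (rule equitable_cells[OF u])
  show "{u} \<in> cells u ` {..<6}"
    using cells_self[OF u] by (metis imageI lessThan_iff zero_less_numeral)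
qed

lemma bipartite_\<Gamma>: "bipartite_graph \<Gamma>"
  unfolding bipartite_graph_def
proof (intro conjI exI)
  show "parcs \<Gamma> \<subseteq> ((V \<times> {1, -1}) \<times> {0}) \<times> ((V \<times> {1, -1}) \<times> {1}) \<union>
      ((V \<times> {1, -1}) \<times> {1}) \<times> ((V \<times> {1, -1}) \<times> {0})"
    using seidel_cases by (fastforce simp: arc_\<Gamma>_iff)
qed (auto simp: pair_graph_\<Gamma> pverts_\<Gamma>)

section \<open>Distances, connectedness and diameter from the diagram\<close>

text \<open>The distance from cell 0 in the diagram. Cell 5 is attached to cell 2 only, hence its
  value 3.\<close>

definition cell_dist :: "nat \<Rightarrow> nat" where
  "cell_dist m = [0, 1, 2, 3, 4, 3] ! m"

text \<open>An arc forces a positive entry of the quotient matrix, and positive entries occur only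
  between cells whose distances from cell 0 differ by one. This yields the lower bound on
  distances.\<close>

lemma cell_dist_arc:
  assumes u: "u \<in> pverts \<Gamma>" and arc: "(v, v') \<in> parcs \<Gamma>"
  shows "cell_dist (cell u v') \<le> Suc (cell_dist (cell u v))"
proof -
  interpret \<Gamma>: pair_graph \<Gamma> by (rule pair_graph_\<Gamma>)
  have v: "v \<in> cells u (cell u v)" and v': "v' \<in> cells u (cell u v')"
    using arc \<Gamma>.in_arcsD1 \<Gamma>.in_arcsD2 by (auto simp: cells_def)
  have "v' \<in> nbrs \<Gamma> v \<inter> cells u (cell u v')"
    using arc v' by (auto simp: nbrs_def)
  moreover have "finite (cells u (cell u v'))"
    using \<Gamma>.pair_finite_verts by (auto simp: cells_def)
  ultimately have "diagram_quotient q (cell u v) (cell u v') > 0"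
    using card_nbrs_cells[OF u v cell_less] by (metis card_gt_0_iff emptyE finite_Int)
  moreover have "cell u v = 0 \<or> cell u v = 1 \<or> cell u v = 2 \<or> cell u v = 3 \<or> cell u v = 4 \<or> cell u v = 5"
    "cell u v' = 0 \<or> cell u v' = 1 \<or> cell u v' = 2 \<or> cell u v' = 3 \<or> cell u v' = 4 \<or> cell u v' = 5"
    using cell_less[of u v] cell_less[of u v'] by linarith+
  ultimately show ?thesis
    by (elim disjE) (simp_all add: diagram_quotient_def cell_dist_def)
qed

lemma cell_dist_le:
  assumes u: "u \<in> pverts \<Gamma>" and "(u, v) \<in> parcs \<Gamma> ^^ n"
  shows "cell_dist (cell u v) \<le> n"
  using assms(2)
proof (induction n arbitrary: v)
  case 0
  have "u \<in> cells u 0"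
    using cells_self[OF u] by simp
  with 0 show ?case
    by (simp add: cells_def cell_dist_def)
next
  case (Suc n)
  then obtain v' where "(u, v') \<in> parcs \<Gamma> ^^ n" "(v', v) \<in> parcs \<Gamma>"
    by (meson relpow_Suc_E)
  with Suc.IH cell_dist_arc[OF u] show ?case
    by (meson Suc_le_mono le_trans)
qed

text \<open>The upper bound on distances: a positive entry provides a neighbour in a cell closer to
  \<open>u\<close>, and the descent runs through cells 4, 3, 2, 1, 0, or from 5 to 2.\<close>

lemma walk_to_cell:
  assumes u: "u \<in> pverts \<Gamma>" and v: "v \<in> cells u m" and m: "m < 6"
  shows "(u, v) \<in> parcs \<Gamma> ^^ cell_dist m"
proof -
  interpret \<Gamma>: pair_graph \<Gamma> by (rule pair_graph_\<Gamma>)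
  have step: "(u, v) \<in> parcs \<Gamma> ^^ Suc d"
    if v: "v \<in> cells u m" and pos: "diagram_quotient q m n > 0" and n: "n < 6"
      and d: "\<And>v'. v' \<in> cells u n \<Longrightarrow> (u, v') \<in> parcs \<Gamma> ^^ d" for v m n d
  proof -
    have "card (nbrs \<Gamma> v \<inter> cells u n) > 0"
      using card_nbrs_cells[OF u v n] pos by simp
    then obtain v' where "(v, v') \<in> parcs \<Gamma>" "v' \<in> cells u n"
      by (auto simp: card_gt_0_iff nbrs_def)
    moreover have "(v', v) \<in> parcs \<Gamma>"
      using calculation \<Gamma>.pair_sym_arcs by (auto simp: symmetric_def dest: symD)
    ultimately show ?thesis
      using d by (meson relpow_Suc_I)
  qed
  have q: "q > 0" "(q - 1) div 2 > 0" "q - 1 > 0"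
    using q_ge_3 by auto
  note [simp] = diagram_quotient_def
  have c0: "(u, v) \<in> parcs \<Gamma> ^^ 0" if "v \<in> cells u 0" for v
    using that cells_self[OF u] by simp
  have c1: "(u, v) \<in> parcs \<Gamma> ^^ 1" if "v \<in> cells u 1" for v
  proof -
    have "(u, v) \<in> parcs \<Gamma> ^^ Suc 0"
      by (rule step[OF that _ _ c0]) (use q in simp_all)
    thus ?thesis by (simp add: eval_nat_numeral del: relpow.simps)
  qed
  have c2: "(u, v) \<in> parcs \<Gamma> ^^ 2" if "v \<in> cells u 2" for v
  proof -
    have "(u, v) \<in> parcs \<Gamma> ^^ Suc 1"
      by (rule step[OF that _ _ c1]) (use q in simp_all)
    thus ?thesis by (simp add: eval_nat_numeral del: relpow.simps)
  qed
  have c3: "(u, v) \<in> parcs \<Gamma> ^^ 3" if "v \<in> cells u 3" for v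
  proof -
    have "(u, v) \<in> parcs \<Gamma> ^^ Suc 2"
      by (rule step[OF that _ _ c2]) (use q in simp_all)
    thus ?thesis by (simp add: eval_nat_numeral del: relpow.simps)
  qed
  have c4: "(u, v) \<in> parcs \<Gamma> ^^ 4" if "v \<in> cells u 4" for v
  proof -
    have "(u, v) \<in> parcs \<Gamma> ^^ Suc 3"
      by (rule step[OF that _ _ c3]) (use q in simp_all)
    thus ?thesis by (simp add: eval_nat_numeral del: relpow.simps)
  qed
  have c5: "(u, v) \<in> parcs \<Gamma> ^^ 3" if "v \<in> cells u 5" for v
  proof -
    have "(u, v) \<in> parcs \<Gamma> ^^ Suc 2"
      by (rule step[OF that _ _ c2]) (use q in simp_all)
    thus ?thesis by (simp add: eval_nat_numeral del: relpow.simps)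
  qed
  have cd: "cell_dist 0 = 0" "cell_dist 1 = 1" "cell_dist 2 = 2" "cell_dist 3 = 3"
    "cell_dist 4 = 4" "cell_dist 5 = 3"
    by (simp_all add: cell_dist_def)
  consider "m = 0" | "m = 1" | "m = 2" | "m = 3" | "m = 4" | "m = 5"
    using m by linarith
  thus ?thesis
  proof cases
    case 1
    with c0[of v] v show ?thesis by (simp only: cd)
  next
    case 2
    with c1[of v] v show ?thesis by (simp only: cd)
  next
    case 3
    with c2[of v] v show ?thesis by (simp only: cd)
  next
    case 4
    with c3[of v] v show ?thesis by (simp only: cd)
  next
    case 5
    with c4[of v] v show ?thesis by (simp only: cd)
  next
    case 6
    with c5[of v] v show ?thesis by (simp only: cd)
  qed
qed

lemma graph_dist_\<Gamma>:
  assumes u: "u \<in> pverts \<Gamma>" and v: "v \<in> pverts \<Gamma>"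
  shows "graph_dist \<Gamma> u v = ereal (real (cell_dist (cell u v)))"
proof -
  interpret \<Gamma>: pair_graph \<Gamma> by (rule pair_graph_\<Gamma>)
  have "v \<in> cells u (cell u v)"
    using v by (simp add: cells_def)
  from walk_to_cell[OF u this cell_less] show ?thesis
    using cell_dist_le[OF u] u by (intro antisym \<Gamma>.graph_dist_le \<Gamma>.graph_dist_ge) auto
qed

lemma V_nonempty: "V \<noteq> {}"
  using card_verts by auto

lemma connected_\<Gamma>: "Digraph_Component.connected (with_proj \<Gamma>)"
proof -
  interpret \<Gamma>: pair_graph \<Gamma> by (rule pair_graph_\<Gamma>)
  have "\<exists>n. (u, v) \<in> parcs \<Gamma> ^^ n" if "u \<in> pverts \<Gamma>" "v \<in> pverts \<Gamma>" for u v
    using walk_to_cell[OF that(1) _ cell_less, of v u v] that(2) unfolding cells_def by blast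
  moreover have "pverts \<Gamma> \<noteq> {}"
    using V_nonempty by (auto simp: pverts_\<Gamma>)
  ultimately show ?thesis
    by (intro \<Gamma>.connected_if_relpow)
qed

lemma graph_diameter_\<Gamma>: "graph_diameter \<Gamma> = 4"
proof (rule antisym)
  have "cell_dist m \<le> 4" if "m < 6" for m
  proof -
    have "m = 0 \<or> m = 1 \<or> m = 2 \<or> m = 3 \<or> m = 4 \<or> m = 5"
      using that by linarith
    thus ?thesis by (auto simp: cell_dist_def)
  qed
  hence le: "cell_dist (cell u v) \<le> 4" for u v
    using cell_less by blast
  have "graph_dist \<Gamma> u v \<le> 4" if "u \<in> pverts \<Gamma>" "v \<in> pverts \<Gamma>" for u v
    using graph_dist_\<Gamma>[OF that] le[of u v] by simp
  thus "graph_diameter \<Gamma> \<le> 4"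
    unfolding graph_diameter_def by (intro SUP_least)
  obtain x where "x \<in> V" using V_nonempty by blast
  \<comment> \<open>The two lifts of one base vertex in the same layer are antipodes, so they attain
    distance 4.\<close>
  define u v where "u = ((x, 1::int), 0::nat)" and "v = ((x, -1::int), 0::nat)"
  have uv: "u \<in> pverts \<Gamma>" "v \<in> pverts \<Gamma>"
    using \<open>x \<in> V\<close> by (simp_all add: u_def v_def pverts_\<Gamma>)
  have "4 = graph_dist \<Gamma> u v"
    unfolding graph_dist_\<Gamma>[OF uv] by (simp add: u_def v_def cell_dist_def cell.simps)
  also have "\<dots> \<le> (SUP y\<in>pverts \<Gamma>. graph_dist \<Gamma> u y)"
    using uv by (intro SUP_upper)
  also have "\<dots> \<le> graph_diameter \<Gamma>"
    unfolding graph_diameter_def using uv by (intro SUP_upper)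
  finally show "4 \<le> graph_diameter \<Gamma>" .
qed

text \<open>
  The neighbourhood of \<open>u\<close> is its cell 1, so the numbers of common neighbours of \<open>u\<close> and
  \<open>v\<close> form the column 1 of the quotient matrix.
\<close>

lemma amply_regular_\<Gamma>: "amply_regular \<Gamma> (4 * (q + 1)) q 0 ((q - 1) div 2)"
proof -
  interpret \<Gamma>: pair_graph \<Gamma> by (rule pair_graph_\<Gamma>)
  have nbrs_sub: "nbrs \<Gamma> v \<subseteq> pverts \<Gamma>" for v
    unfolding nbrs_def using \<Gamma>.in_arcsD2 by blast
  \<comment> \<open>Row 0 of the matrix puts \<open>q\<close> neighbours into cell 1, and both the
    neighbourhood and the cell have only \<open>q\<close> elements.\<close>
  have nbrs: "nbrs \<Gamma> u = cells u 1" if u: "u \<in> pverts \<Gamma>" for u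
  proof -
    have "u \<in> cells u 0"
      using cells_self[OF u] by simp
    hence "card (nbrs \<Gamma> u \<inter> cells u 1) = q"
      using card_nbrs_cells[OF u, of u 0 1] by (simp add: diagram_quotient_def)
    moreover have "card (cells u 1) = q"
      using card_cells[OF u, of 1] by (simp add: diagram_sizes_def)
    moreover have "card (nbrs \<Gamma> u) = q"
    proof -
      obtain x \<delta> i where "u = ((x, \<delta>), i)" "x \<in> V" "\<delta> \<in> {1, -1}" "i \<in> {0, 1}"
        using u by (auto simp: pverts_\<Gamma>)
      thus ?thesis
        using nbrs_\<Gamma>[of x \<delta> i] finite_V by (simp add: card_image inj_on_def card_verts)
    qed
    moreover have "finite (nbrs \<Gamma> u)" "finite (cells u 1)"
      using finite_subset[OF nbrs_sub \<Gamma>.pair_finite_verts] \<Gamma>.pair_finite_verts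
      by (simp_all add: cells_def)
    ultimately show ?thesis
      by (metis Int_lower1 Int_lower2 card_subset_eq)
  qed
  have common: "card (nbrs \<Gamma> u \<inter> nbrs \<Gamma> v) = diagram_quotient q (cell u v) 1"
    if "u \<in> pverts \<Gamma>" "v \<in> pverts \<Gamma>" for u v
    using card_nbrs_cells[OF that(1), of v "cell u v" 1] that nbrs[OF that(1)]
    by (simp add: cells_def Int_commute)
  have cell1: "cell u v = 1" if "u \<in> pverts \<Gamma>" "(u, v) \<in> parcs \<Gamma>" for u v
    using nbrs[OF that(1)] that by (auto simp: nbrs_def cells_def)
  have cell2: "cell u v = 2" if "u \<in> pverts \<Gamma>" "v \<in> pverts \<Gamma>" "graph_dist \<Gamma> u v = 2" for u v
  proof -
    have "cell_dist (cell u v) = 2"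
      using graph_dist_\<Gamma>[OF that(1,2)] that(3) by simp
    moreover have "cell u v = 0 \<or> cell u v = 1 \<or> cell u v = 2 \<or> cell u v = 3 \<or> cell u v = 4 \<or> cell u v = 5"
      using cell_less[of u v] by linarith
    ultimately show ?thesis
      by (auto simp: cell_dist_def)
  qed
  have "card (pverts \<Gamma>) = 4 * (q + 1)"
    by (simp add: pverts_\<Gamma> card_cartesian_product card_verts)
  moreover have "card (nbrs \<Gamma> u) = q" if "u \<in> pverts \<Gamma>" for u
    using nbrs[OF that] card_cells[OF that, of 1] by (simp add: diagram_sizes_def)
  moreover have "card (nbrs \<Gamma> u \<inter> nbrs \<Gamma> v) = 0"
    if "u \<in> pverts \<Gamma>" "v \<in> pverts \<Gamma>" "(u, v) \<in> parcs \<Gamma>" for u v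
    unfolding common[OF that(1,2)] cell1[OF that(1,3)] by (simp add: diagram_quotient_def)
  moreover have "card (nbrs \<Gamma> u \<inter> nbrs \<Gamma> v) = (q - 1) div 2"
    if "u \<in> pverts \<Gamma>" "v \<in> pverts \<Gamma>" "graph_dist \<Gamma> u v = 2" for u v
    unfolding common[OF that(1,2)] cell2[OF that] by (simp add: diagram_quotient_def)
  ultimately show ?thesis
    unfolding amply_regular_def by (intro conjI ballI impI pair_graph_\<Gamma>)
qed

end

section \<open>Paley and Peisert graphs\<close>

text \<open>A sign is twice an indicator minus one, so a vanishing sum of signs says that exactly
  half of them are 1.\<close>

lemma sum_signs:
  fixes f :: "'b \<Rightarrow> real"
  assumes "finite A" and "\<And>z. z \<in> A \<Longrightarrow> f z = 1 \<or> f z = -1"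
  shows "sum f A = 2 * real (card {z \<in> A. f z = 1}) - real (card A)"
proof -
  have "sum f A = (\<Sum>z\<in>A. 2 * of_bool (f z = 1) - 1)"
    by (rule sum.cong) (use assms(2) in auto)
  also have "\<dots> = 2 * (\<Sum>z\<in>A. of_bool (f z = 1)) - real (card A)"
    by (simp add: sum_subtractf sum_distrib_left)
  also have "(\<Sum>z\<in>A. of_bool (f z = 1)) = real (card {z \<in> A. f z = 1})"
    using assms(1) by (simp add: Int_def)
  finally show ?thesis .
qed

text \<open>The block \<open>\<chi> (a - b)\<close> is bordered by ones for \<infinity>. The row of
  \<infinity> is orthogonal to the others because \<chi> sums to 0; two other rows contribute -1
  from \<open>sum_shift\<close> and 1 from the column of \<infinity>.\<close>

lemma conference_graph_add_infinity:
  fixes \<chi> :: "'a::{field, finite} \<Rightarrow> real"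
  assumes verts: "pverts D = UNIV" and arcs: "parcs D = {(x, y). \<chi> (x - y) = 1}"
    and \<chi>_0: "\<chi> 0 = 0" and \<chi>_sign: "\<And>x. x \<noteq> 0 \<Longrightarrow> \<chi> x = 1 \<or> \<chi> x = -1"
    and \<chi>_even: "\<And>x. \<chi> (- x) = \<chi> x"
    and sum_\<chi>: "(\<Sum>x\<in>UNIV. \<chi> x) = 0"
    and sum_shift: "\<And>a. a \<noteq> 0 \<Longrightarrow> (\<Sum>x\<in>UNIV. \<chi> (x + a) * \<chi> x) = -1"
    and q: "odd CARD('a)" "CARD('a) \<ge> 3"
  shows "conference_graph (add_infinity D) CARD('a)"
proof -
  let ?H = "add_infinity D"
  \<comment> \<open>The diagonal is 0, unlike in \<open>seidel\<close>, so the sum over all columns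
    can later be restricted to those other than \<open>x\<close> and \<open>y\<close>.\<close>
  define c :: "'a option \<Rightarrow> 'a option \<Rightarrow> real" where
    "c x y = (case x of None \<Rightarrow> (case y of None \<Rightarrow> 0 | Some b \<Rightarrow> 1)
                | Some a \<Rightarrow> (case y of None \<Rightarrow> 1 | Some b \<Rightarrow> \<chi> (a - b)))" for x y
  have vH: "pverts ?H = UNIV"
    by (simp add: add_infinity_def verts UNIV_option_conv)
  have aH: "(x, y) \<in> parcs ?H \<longleftrightarrow> c x y = 1" for x y
    by (auto simp: add_infinity_def verts arcs c_def split: option.splits)
  have c_diag: "c x x = 0" for x
    by (simp add: c_def \<chi>_0 split: option.split)
  have c_sign: "c x y = 1 \<or> c x y = -1" if "x \<noteq> y" for x y
    using that \<chi>_sign[of "the x - the y"] by (auto simp: c_def split: option.split)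
  have c_sym: "c x y = c y x" for x y
    using \<chi>_even[of "the x - the y"] by (auto simp: c_def split: option.split)
  have sum_refl: "(\<Sum>z\<in>UNIV. \<chi> (b - z)) = 0" for b
  proof -
    have "(\<Sum>z\<in>UNIV. \<chi> (b - z)) = (\<Sum>z\<in>UNIV. \<chi> z)"
      by (rule sum.reindex_bij_witness[of _ "\<lambda>z. b - z" "\<lambda>z. b - z"]) auto
    thus ?thesis using sum_\<chi> by simp
  qed
  have sum_refl2: "(\<Sum>z\<in>UNIV. \<chi> (a - z) * \<chi> (b - z)) = -1" if "a \<noteq> b" for a b
  proof -
    have "(\<Sum>z\<in>UNIV. \<chi> (a - z) * \<chi> (b - z)) = (\<Sum>z\<in>UNIV. \<chi> (z + (a - b)) * \<chi> z)"
      by (rule sum.reindex_bij_witness[of _ "\<lambda>z. b - z" "\<lambda>z. b - z"]) (auto simp: algebra_simps)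
    thus ?thesis using sum_shift[of "a - b"] that by simp
  qed
  have orth: "(\<Sum>z\<in>UNIV. c x z * c y z) = 0" if "x \<noteq> y" for x y
  proof -
    have "(\<Sum>z\<in>UNIV. c x z * c y z) =
        c x None * c y None + (\<Sum>z\<in>UNIV. c x (Some z) * c y (Some z))"
      by (simp add: UNIV_option_conv sum.reindex)
    also have "\<dots> = 0"
      using that sum_refl sum_refl2 by (cases x; cases y) (simp_all add: c_def)
    finally show ?thesis .
  qed
  show ?thesis
  proof
    show "finite (pverts ?H)" "finite (parcs ?H)"
      by simp_all
    show "fst e \<in> pverts ?H" "snd e \<in> pverts ?H" for e
      by (simp_all add: vH)
    show "fst e \<noteq> snd e" if "e \<in> parcs ?H" for e
      using that c_diag by (cases e) (auto simp: aH)
    show "symmetric ?H"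
      using c_sym by (auto simp: symmetric_def aH intro!: symI)
    show "card (pverts ?H) = Suc CARD('a)"
      by (simp add: vH)
    show "odd CARD('a)" "CARD('a) \<ge> 3"
      by (fact q)+
    fix x y assume "x \<in> pverts ?H" "y \<in> pverts ?H" and xy: "x \<noteq> y"
    let ?A = "UNIV - {x, y}"
    have "0 = (\<Sum>z\<in>UNIV. c x z * c y z)"
      using orth[OF xy] by simp
    also have "\<dots> = (\<Sum>z\<in>?A. c x z * c y z)"
      by (rule sum.mono_neutral_right) (auto simp: c_diag)
    also have "\<dots> = 2 * real (card {z \<in> ?A. c x z * c y z = 1}) - real (card ?A)"
    proof (rule sum_signs)
      show "c x z * c y z = 1 \<or> c x z * c y z = -1" if "z \<in> ?A" for z
        using c_sign[of x z] c_sign[of y z] that by auto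
    qed simp
    also have "{z \<in> ?A. c x z * c y z = 1} =
        {z \<in> pverts ?H - {x, y}. (x, z) \<in> parcs ?H \<longleftrightarrow> (y, z) \<in> parcs ?H}"
    proof -
      have "c x z * c y z = 1 \<longleftrightarrow> (c x z = 1 \<longleftrightarrow> c y z = 1)" if "z \<in> ?A" for z
        using c_sign[of x z] c_sign[of y z] that by auto
      thus ?thesis unfolding vH aH by blast
    qed
    also have "card ?A = CARD('a) - 1"
      using xy by (simp add: card_Diff_subset)
    finally show "card {z \<in> pverts ?H - {x, y}. (x, z) \<in> parcs ?H \<longleftrightarrow> (y, z) \<in> parcs ?H} =
        (CARD('a) - 1) div 2"
      by linarith
  qed
qed

text \<open>Treats both families at once: \<open>u = -1\<close> with the identity for Paley,
  \<open>u = \<i>\<close> with the Frobenius map for Peisert.\<close>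

lemma conference_graph_character:
  fixes w :: "'a::{field, finite}"
  defines "\<psi> u \<equiv> power_character w u"
  assumes w: "primitive_root w" and u: "u = -1 \<or> u = \<i>"
    and q: "odd CARD('a)" "CARD('a) \<ge> 3" and half: "u ^ ((CARD('a) - 1) div 2) = 1"
    and f: "\<And>x y. f (x + y) = f x + f y" "bij f" "\<And>x. \<psi> u (f x) = cnj (\<psi> u x)"
    and D: "pverts D = UNIV" "parcs D = {(x, y). Re (\<psi> u (x - y)) + Im (\<psi> u (x - y)) = 1}"
  shows "conference_graph (add_infinity D) CARD('a)"
proof -
  have "u ^ (CARD('a) - 1) = (u ^ ((CARD('a) - 1) div 2)) ^ 2"
    using q by (simp flip: power_mult)
  also have "\<dots> = 1"
    by (simp only: half power_one)
  finally have u1: "u ^ (CARD('a) - 1) = 1" .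
  note pw = power_character_power[OF w u1, folded \<psi>_def]
  interpret mult_character "\<psi> u"
    unfolding \<psi>_def using u by (intro mult_character_power_character w u1) auto
  have u4: "u ^ 4 = 1"
    using u by auto
  have quartic: "\<psi> u x ^ 4 = 1" if "x \<noteq> 0" for x
  proof -
    obtain j where "x = w ^ j" using nonzero_is_power[OF w \<open>x \<noteq> 0\<close>] .
    hence "\<psi> u x ^ 4 = (u ^ 4) ^ j" by (simp add: pw mult.commute flip: power_mult)
    thus ?thesis by (simp add: u4)
  qed
  show ?thesis
  proof (rule conference_graph_add_infinity[where \<chi> = "\<lambda>x. Re (\<psi> u x) + Im (\<psi> u x)"])
    \<comment> \<open>The values are fourth roots of unity; real plus imaginary part is 1 at 1 and
      \<i>, and -1 at their negatives.\<close>
    show "Re (\<psi> u x) + Im (\<psi> u x) = 1 \<or> Re (\<psi> u x) + Im (\<psi> u x) = -1" if "x \<noteq> 0" for x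
    proof -
      have "((\<psi> u x)\<^sup>2)\<^sup>2 = 1"
        using quartic[OF that] by (simp flip: power_mult)
      hence "(\<psi> u x)\<^sup>2 = 1 \<or> (\<psi> u x)\<^sup>2 = -1"
        by (rule power2_eq_1_iff[THEN iffD1])
      moreover have "z = \<i> \<or> z = - \<i>" if "z\<^sup>2 = -1" for z :: complex
        using that by (metis power2_eq_iff power2_i)
      ultimately have "\<psi> u x = 1 \<or> \<psi> u x = -1 \<or> \<psi> u x = \<i> \<or> \<psi> u x = - \<i>"
        by (metis power2_eq_1_iff)
      thus ?thesis by auto
    qed
    \<comment> \<open>-1 is the power of \<open>w\<close> with exponent
      \<open>(CARD('a) - 1) div 2\<close>, so \<open>half\<close> makes \<psi> even and adjacency
      symmetric.\<close>
    have "\<psi> u (-1) = 1"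
      using minus_one_eq_power[OF w] q pw half by simp
    thus "Re (\<psi> u (- x)) + Im (\<psi> u (- x)) = Re (\<psi> u x) + Im (\<psi> u x)" for x
      using char_mult[of "-1" x] by simp
    show "(\<Sum>x\<in>UNIV. (Re (\<psi> u (x + a)) + Im (\<psi> u (x + a))) * (Re (\<psi> u x) + Im (\<psi> u x))) = -1"
      if "a \<noteq> 0" for a
      using that by (intro sum_Re_Im_shift Im_sum_shift_eq_0[OF f quartic])
  qed (use D q sum_Re_Im char_0 in auto)
qed

section \<open>The Paley and Peisert cases\<close>

lemma conference_graph_paley:
  assumes "[CARD('a) = 1] (mod 4)"
  shows "conference_graph (add_infinity (paley_graph :: 'a::{field, finite} pair_pre_digraph)) CARD('a)"
proof -
  obtain w :: 'a where w: "primitive_root w"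
    using exists_primitive_root by blast
  have "CARD('a) > 1"
    using card_mono[of UNIV "{0, 1 :: 'a}"] by simp
  moreover have "CARD('a) mod 4 = 1"
    using assms by (simp add: cong_def)
  ultimately have q: "odd CARD('a)" "CARD('a) \<ge> 3" "even ((CARD('a) - 1) div 2)"
    by presburger+
  hence pw: "power_character w (- 1) (w ^ j) = (- 1) ^ j" for j
    by (intro power_character_power[OF w]) simp
  have char_0: "power_character w u 0 = 0" for u
    by (simp add: power_character_def)
  show ?thesis
  proof (rule conference_graph_character[OF w, where u = "-1" and f = id])
    show "power_character w (- 1) (id x) = cnj (power_character w (- 1) x)" for x
      by (cases "x = 0") (auto simp: char_0 pw elim: nonzero_is_power[OF w])
    have square_iff: "(\<exists>z. x = z\<^sup>2) \<longleftrightarrow>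
        Re (power_character w (- 1) x) + Im (power_character w (- 1) x) = 1" if "x \<noteq> 0" for x
    proof -
      obtain j where j: "x = w ^ j" using nonzero_is_power[OF w \<open>x \<noteq> 0\<close>] .
      \<comment> \<open>Exponents of \<open>x\<close> are not unique, so the parity of
        \<open>j\<close> is compared with that of \<open>2 * i\<close> through the values of the
        character.\<close>
      have "(\<exists>z. x = z\<^sup>2) \<longleftrightarrow> even j"
      proof
        assume "\<exists>z. x = z\<^sup>2"
        then obtain z where z: "x = z\<^sup>2" by blast
        hence "z \<noteq> 0" using \<open>x \<noteq> 0\<close> by auto
        then obtain i where "z = w ^ i" using nonzero_is_power[OF w] by metis
        hence "x = w ^ (2 * i)" using z by (simp flip: power_mult add: mult.commute)
        hence "(- 1 :: complex) ^ j = (- 1) ^ (2 * i)" using pw j by metis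
        thus "even j" by (cases "even j") auto
      next
        assume "even j"
        thus "\<exists>z. x = z\<^sup>2" by (metis j dvdE mult.commute power_mult)
      qed
      thus ?thesis by (cases "even j") (auto simp: j pw)
    qed
    have "x \<noteq> y \<and> x - y \<noteq> 0 \<and> (\<exists>z. x - y = z\<^sup>2) \<longleftrightarrow>
        Re (power_character w (- 1) (x - y)) + Im (power_character w (- 1) (x - y)) = 1" for x y
      using square_iff[of "x - y"] by (cases "x = y") (simp_all add: char_0)
    thus "parcs paley_graph = {(x :: 'a, y).
        Re (power_character w (- 1) (x - y)) + Im (power_character w (- 1) (x - y)) = 1}"
      by (simp only: paley_graph_def pair_pre_digraph.simps)
  qed (use q in \<open>auto simp: paley_graph_def\<close>)
qed

lemma conference_graph_peisert:
  fixes w :: "'a::{field, finite}"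
  assumes p: "prime p" "[p = 3] (mod 4)" and "even r" and card: "CARD('a) = p ^ r"
    and w: "primitive_root w"
  shows "conference_graph (add_infinity (peisert_graph w)) CARD('a)"
proof -
  have p4: "p mod 4 = 3"
    using p(2) by (simp add: cong_def)
  obtain t where t: "p = 4 * t + 3"
    using p4 by (metis mod_mult_div_eq mult.commute add.commute)
  \<comment> \<open>An odd square is 1 modulo 8, and \<open>CARD('a)\<close> is a power of
    \<open>p ^ 2\<close>. Hence 4 divides \<open>(CARD('a) - 1) div 2\<close>, as needed for
    \<open>half\<close> with \<open>u = \<i>\<close>.\<close>
  have q8: "CARD('a) mod 8 = 1"
  proof -
    obtain s where r: "r = 2 * s" using \<open>even r\<close> by blast
    have "p ^ 2 = 8 * (2 * t ^ 2 + 3 * t + 1) + 1"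
      unfolding t by (simp add: power2_eq_square algebra_simps)
    hence "p ^ 2 mod 8 = 1" by presburger
    hence "(p ^ 2) ^ s mod 8 = 1" by (metis power_mod power_one mod_less one_less_numeral_iff semiring_norm(76))
    thus ?thesis by (simp add: card r power_mult)
  qed
  have "CARD('a) > 1"
    using card_mono[of UNIV "{0, 1 :: 'a}"] by simp
  with q8 have q: "odd CARD('a)" "CARD('a) \<ge> 3" and dvd: "4 dvd (CARD('a) - 1) div 2"
    by presburger+
  have half: "\<i> ^ ((CARD('a) - 1) div 2) = 1"
    using dvd by (auto simp: power_mult elim!: dvdE)
  have "\<i> ^ (CARD('a) - 1) = (\<i> ^ ((CARD('a) - 1) div 2)) ^ 2"
    using q by (simp flip: power_mult)
  hence pw: "power_character w \<i> (w ^ j) = \<i> ^ j" for j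
    using half by (intro power_character_power[OF w]) simp
  have char_0: "power_character w u 0 = 0" for u
    by (simp add: power_character_def)
  have char: "CHAR('a) = p"
    using char_of_card_prime_power[OF p(1) card] .
  have frob: "(x + y) ^ p = x ^ p + y ^ p" for x y :: 'a
    by (rule freshmans_dream) (simp_all add: char p(1))
  show ?thesis
  proof (rule conference_graph_character[OF w _ q half, where f = "\<lambda>x. x ^ p"])
    have "x = y" if "x ^ p = y ^ p" for x y :: 'a
    proof -
      have "(x - y) ^ p + y ^ p = x ^ p"
        using frob[of "x - y" y] by simp
      thus ?thesis using that by simp
    qed
    hence "inj (\<lambda>x :: 'a. x ^ p)"
      by (rule injI)
    thus "bij (\<lambda>x :: 'a. x ^ p)"
      by (simp add: bij_def finite_UNIV_inj_surj)
    \<comment> \<open>As \<open>p\<close> is 3 modulo 4, this power is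
      \<open>\<i> ^ 3 = - \<i>\<close>. Raising \<open>x\<close> to the power \<open>p\<close>
      raises its character value to the same power, so Frobenius acts as conjugation.\<close>
    have "\<i> ^ p = cnj \<i>"
      unfolding t by (simp add: power_add power_mult power3_eq_cube)
    hence "power_character w \<i> ((w ^ j) ^ p) = cnj (power_character w \<i> (w ^ j))" for j
      unfolding power_mult[symmetric] pw by (simp add: mult.commute[of j p] power_mult)
    thus "power_character w \<i> (x ^ p) = cnj (power_character w \<i> x)" for x
      using prime_gt_0_nat[OF p(1)] nonzero_is_power[OF w, of x]
      by (cases "x = 0") (auto simp: char_0 zero_power)
    have mem_iff: "x \<in> {w ^ j | j :: nat. [j = 0] (mod 4) \<or> [j = 1] (mod 4)} \<longleftrightarrow>
        Re (power_character w \<i> x) + Im (power_character w \<i> x) = 1" if "x \<noteq> 0" for x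
    proof -
      \<comment> \<open>This matches the exponent classes 0 and 1 modulo 4 with the character values
        1 and \<i>.\<close>
      have i_power: "Re (\<i> ^ j) + Im (\<i> ^ j) = 1 \<longleftrightarrow> [j = 0] (mod 4) \<or> [j = 1] (mod 4)" for j :: nat
      proof -
        have "\<i> ^ j = (\<i> ^ 4) ^ (j div 4) * \<i> ^ (j mod 4)"
          by (simp only: power_mult[symmetric] power_add[symmetric] mult_div_mod_eq)
        hence "\<i> ^ j = \<i> ^ (j mod 4)"
          by simp
        moreover have "j mod 4 = 0 \<or> j mod 4 = 1 \<or> j mod 4 = 2 \<or> j mod 4 = 3"
          by presburger
        ultimately show ?thesis
          by (auto simp: cong_def power3_eq_cube)
      qed
      obtain j where j: "x = w ^ j" using nonzero_is_power[OF w \<open>x \<noteq> 0\<close>] .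
      show ?thesis
      proof
        assume "x \<in> {w ^ j | j :: nat. [j = 0] (mod 4) \<or> [j = 1] (mod 4)}"
        then obtain k where "x = w ^ k" "[k = 0] (mod 4) \<or> [k = 1] (mod 4)" by blast
        thus "Re (power_character w \<i> x) + Im (power_character w \<i> x) = 1"
          by (simp only: pw i_power)
      next
        assume "Re (power_character w \<i> x) + Im (power_character w \<i> x) = 1"
        hence "[j = 0] (mod 4) \<or> [j = 1] (mod 4)"
          by (simp only: j pw i_power)
        thus "x \<in> {w ^ j | j :: nat. [j = 0] (mod 4) \<or> [j = 1] (mod 4)}"
          using j by blast
      qed
    qed
    have "x \<noteq> y \<and> x - y \<in> {w ^ j | j :: nat. [j = 0] (mod 4) \<or> [j = 1] (mod 4)} \<longleftrightarrow>
        Re (power_character w \<i> (x - y)) + Im (power_character w \<i> (x - y)) = 1" for x y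
    proof (cases "x = y")
      case False
      thus ?thesis using mem_iff[of "x - y"] by (simp only: right_minus_eq) simp
    qed (simp add: char_0)
    thus "parcs (peisert_graph w) = {(x, y).
        Re (power_character w \<i> (x - y)) + Im (power_character w \<i> (x - y)) = 1}"
      by (simp only: peisert_graph_def pair_pre_digraph.simps)
  qed (use frob in \<open>auto simp: peisert_graph_def\<close>)
qed

theorem proposition3p1:
  fixes \<Delta> :: "'a::{field, finite} pair_pre_digraph"
    and \<Sigma> :: "('a option \<times> int) pair_pre_digraph"
    and \<Gamma> :: "(('a option \<times> int) \<times> nat) pair_pre_digraph"
    and p r q :: nat
  assumes "prime p" and "r > 0" and "q = p ^ r" and "CARD('a) = q"
    and "([q = 1] (mod 4) \<and> \<Delta> = paley_graph) \<or>
         ([p = 3] (mod 4) \<and> even r \<and> q \<ge> 5 \<and>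
            (\<exists>w. primitive_root w \<and> \<Delta> = peisert_graph w))"
    and "\<Sigma> = taylor_extension \<Delta>"
    and "\<Gamma> = bipartite_double \<Sigma>"
  shows "Digraph_Component.connected (with_proj \<Gamma>) \<and>
         bipartite_graph \<Gamma> \<and>
         amply_regular \<Gamma> (4 * (q + 1)) q 0 ((q - 1) div 2) \<and>
         graph_diameter \<Gamma> = 4 \<and>
         Q_regular \<Gamma> 6 (diagram_quotient q) \<and>
         Q_regular_with_diagram \<Gamma> 6 (diagram_sizes q) (diagram_quotient q)"
proof -
  have "conference_graph (add_infinity \<Delta>) q"
    using assms conference_graph_paley[where 'a = 'a] conference_graph_peisert[where 'a = 'a]
    by auto
  \<comment> \<open>The base graph of the locale is \<Delta> with \<infinity> added, so its Taylor
    double is \<Sigma>.\<close>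
  then interpret conference_graph "add_infinity \<Delta>" q .
  show ?thesis
    unfolding assms(6,7) taylor_extension_def
    by (intro conjI connected_\<Gamma> bipartite_\<Gamma> amply_regular_\<Gamma> graph_diameter_\<Gamma> Q_regular_\<Gamma>
        Q_regular_with_diagram_\<Gamma>)
qed

end
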